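(* The particular integral of the second order linear inhomogeneous ordinary differential equation $$\frac{d^2y}{dx^2}+p_1(x)\frac{dy}{dx}+p_2(x)y=q(x),\qquad q(x)\neq 0,$$ is given as $$c_1(x)\,y_1(x)+c_2(x)\,y_2(x),$$ where $y_1(x)$ and $y_2(x)$ are two linearly independent solutions of the corresponding homogeneous equation $\frac{d^2y}{dx^2}+p_1(x)\frac{dy}{dx}+p_2(x)y=0$, and $c_1(x),c_2(x)$ are functions of $x$.
   Context: A particular integral of a linear nonhomogeneous ODE is a function which satisfies the nonhomogeneous ODE but is not a solution of the corresponding homogeneous linear ODE.
   Formalization: The functions p1, p2 and q are assumed continuous on a nondegenerate interval; for arbitrary coefficients the claim fails (y1 = x^4, y2 = x^5 both vanish at 0, while y = 1 solves a suitable inhomogeneous equation). *)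

theory Defs
  imports "HOL-Analysis.Analysis"
begin

text \<open>Solutions on \<open>I\<close> of \<open>y'' + p1 y' + p2 y = q\<close>. Derivatives are taken within \<open>I\<close>,
  so that they are one-sided at any endpoint belonging to \<open>I\<close>.\<close>

definition solves_ode2 ::
  "real set \<Rightarrow> (real \<Rightarrow> real) \<Rightarrow> (real \<Rightarrow> real) \<Rightarrow> (real \<Rightarrow> real) \<Rightarrow> (real \<Rightarrow> real) \<Rightarrow> bool"
  where "solves_ode2 I p1 p2 q y \<longleftrightarrow>
    (\<exists>y' y''. \<forall>x\<in>I.
       (y has_real_derivative y' x) (at x within I) \<and>
       (y' has_real_derivative y'' x) (at x within I) \<and>
       y'' x + p1 x * y' x + p2 x * y x = q x)"

definition particular_integral ::
  "real set \<Rightarrow> (real \<Rightarrow> real) \<Rightarrow> (real \<Rightarrow> real) \<Rightarrow> (real \<Rightarrow> real) \<Rightarrow> (real \<Rightarrow> real) \<Rightarrow> bool"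
  where "particular_integral I p1 p2 q y \<longleftrightarrow>
    solves_ode2 I p1 p2 q y \<and> \<not> solves_ode2 I p1 p2 (\<lambda>_. 0) y"

text \<open>Linear independence over the reals of the restrictions to \<open>I\<close>; the library notion
  \<open>independent\<close> would compare the functions on all of the real line.\<close>

definition lin_indep_on :: "real set \<Rightarrow> (real \<Rightarrow> real) \<Rightarrow> (real \<Rightarrow> real) \<Rightarrow> bool"
  where "lin_indep_on I f g \<longleftrightarrow>
    (\<forall>a b. (\<forall>x\<in>I. a * f x + b * g x = 0) \<longrightarrow> a = 0 \<and> b = 0)"

end

theory Submission
  imports Defs
begin

text \<open>
  The representation rests on one fact: the Wronskian
  \<open>W = y1 y2' - y2 y1'\<close> of two independent solutions has no zero in \<open>I\<close>
  (lemma \<open>wronskian_nonzero\<close>). At a zero of \<open>W\<close> some nontrivial combination of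
  \<open>y1\<close> and \<open>y2\<close> vanishes together with its derivative; by uniqueness for
  the initial value problem it vanishes on all of \<open>I\<close>, against independence. Uniqueness
  (lemma \<open>homogeneous_unique\<close>) is an energy estimate: \<open>E = u\<^sup>2 + u'\<^sup>2\<close> satisfies
  \<open>\<bar>E'\<bar> \<le> k E\<close> with \<open>k\<close> continuous, so \<open>E\<close> times one of the integrating factors
  \<open>exp (- \<integral>k)\<close>, \<open>exp (\<integral>k)\<close> is monotone on either side of a zero.

  Once \<open>W\<close> is invertible, a particular integral of the required form is found by variation of
  parameters: \<open>c1' y1 + c2' y2 = 0\<close> and \<open>c1' y1' + c2' y2' = q\<close> is a linear system
  with determinant \<open>W\<close>, whose solution is continuous and hence has antiderivatives on \<open>I\<close>.
  It fails the homogeneous equation because second derivatives within \<open>I\<close> are unique and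
  \<open>q\<close> is not identically zero. Conversely, every given particular integral \<open>y\<close> is
  written by Cramer's rule, which solves \<open>c1 y1 + c2 y2 = y\<close>,
  \<open>c1 y1' + c2 y2' = y'\<close> for \<open>c1\<close> and \<open>c2\<close>; these are differentiable since
  \<open>y\<close>, \<open>y1\<close>, \<open>y2\<close> are twice differentiable.
\<close>

section \<open>Antiderivatives and monotonicity on intervals\<close>

text \<open>The interval may be open, half-open or unbounded, so the antiderivative is the integral from
  a base point \<open>a\<close>, and near each \<open>x\<close> it is compared with an integral over a compact
  subinterval that contains \<open>a\<close> and a neighbourhood of \<open>x\<close> in \<open>I\<close>.\<close>

lemma antiderivative_on_interval:
  fixes f :: "real \<Rightarrow> real"
  assumes I: "is_interval I" and f: "continuous_on I f"
  shows "\<exists>F. \<forall>x\<in>I. (F has_real_derivative f x) (at x within I)"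
proof (cases "I = {}")
  case False
  then obtain a where a: "a \<in> I" by blast
  define F where "F = (\<lambda>x. if a \<le> x then integral {a..x} f else - integral {x..a} f)"
  have "(F has_real_derivative f x) (at x within I)" if x: "x \<in> I" for x
  proof -
    obtain c where c: "c \<in> I" "c \<le> x" "c \<le> a" "(\<forall>z\<in>I. x \<le> z) \<or> c < x"
    proof (cases "\<forall>z\<in>I. x \<le> z")
      case True
      then show ?thesis using that[of x] x a by auto
    next
      case False
      then obtain z where "z \<in> I" "z < x" by force
      then show ?thesis using that[of "min z a"] a by (auto simp: min_def)
    qed
    obtain d where d: "d \<in> I" "x \<le> d" "a \<le> d" "(\<forall>z\<in>I. z \<le> x) \<or> x < d"
    proof (cases "\<forall>z\<in>I. z \<le> x")
      case True
      then show ?thesis using that[of x] x a by auto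
    next
      case False
      then obtain z where "z \<in> I" "x < z" by force
      then show ?thesis using that[of "max z a"] a by (auto simp: max_def)
    qed
    have sub: "{c..d} \<subseteq> I"
      using I c(1) d(1) by (meson atLeastAtMost_iff is_interval_1 subsetI)
    have cont: "continuous_on {c..d} f"
      using f sub continuous_on_subset by blast
    have int: "f integrable_on {u..v}" if "c \<le> u" "v \<le> d" for u v
      using that by (intro integrable_continuous_real continuous_on_subset[OF cont]) auto
    have F_eq: "F y = integral {c..y} f - integral {c..a} f" if y: "y \<in> {c..d}" for y
    proof (cases "a \<le> y")
      case True
      have "integral {c..a} f + integral {a..y} f = integral {c..y} f"
        using True y c d by (intro Henstock_Kurzweil_Integration.integral_combine int) auto
      then show ?thesis using True by (simp add: F_def)
    next
      case False
      have "integral {c..y} f + integral {y..a} f = integral {c..a} f"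
        using False y c d by (intro Henstock_Kurzweil_Integration.integral_combine int) auto
      then show ?thesis using False by (simp add: F_def)
    qed
    have "((\<lambda>y. integral {c..y} f) has_real_derivative f x) (at x within {c..d})"
      using cont c d by (intro integral_has_real_derivative) auto
    then have "((\<lambda>y. integral {c..y} f - integral {c..a} f) has_real_derivative f x)
        (at x within {c..d})"
      by (auto intro!: derivative_eq_intros)
    then have "(F has_real_derivative f x) (at x within {c..d})"
      unfolding has_field_derivative_def
      by (rule has_derivative_transform[rotated 2]) (use c d F_eq in auto)
    moreover have "at x within I = at x within {c..d}"
    proof (rule at_within_nhd)
      let ?S = "{(if c < x then c else x - 1)<..<(if x < d then d else x + 1)}"
      show "x \<in> ?S" "open ?S" by auto
      show "I \<inter> ?S - {x} = {c..d} \<inter> ?S - {x}"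
      proof -
        have "c \<le> z \<and> z \<le> d" if z: "z \<in> I" "z \<in> ?S" for z
        proof -
          have "x \<le> z \<or> c < x" "z \<le> x \<or> x < d"
            using z(1) c(4) d(4) by blast+
          then show ?thesis
            using z(2) c(2) d(2) by (simp split: if_splits)
        qed
        then show ?thesis using sub by auto
      qed
    qed
    ultimately show ?thesis by simp
  qed
  then show ?thesis by blast
qed simp

lemma nondecreasing_on_interval:
  fixes f :: "real \<Rightarrow> real"
  assumes I: "is_interval I" and ab: "a \<in> I" "b \<in> I" "a \<le> b"
    and der: "\<And>x. x \<in> I \<Longrightarrow> (f has_real_derivative f' x) (at x within I)"
    and nonneg: "\<And>x. x \<in> I \<Longrightarrow> 0 \<le> f' x"
  shows "f a \<le> f b"
proof (cases "a = b")
  case False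
  have sub: "{a..b} \<subseteq> I"
    using I ab by (meson atLeastAtMost_iff is_interval_1 subsetI)
  have "\<exists>x\<in>{a<..<b}. f b - f a = f' x * (b - a)"
  proof (rule mvt_simple)
    show "a < b" using False ab by simp
    show "(f has_derivative (*) (f' x)) (at x within {a..b})" if "a \<le> x" "x \<le> b" for x
      using der[of x] sub that
      by (meson DERIV_subset atLeastAtMost_iff has_field_derivative_imp_has_derivative subsetD)
  qed
  then obtain x where "x \<in> {a<..<b}" "f b - f a = f' x * (b - a)" by blast
  moreover have "0 \<le> f' x"
    using calculation sub by (intro nonneg) auto
  ultimately show ?thesis
    using ab(3) by (metis diff_ge_0_iff_ge mult_nonneg_nonneg)
qed simp

section \<open>Uniqueness and the Wronskian\<close>

text \<open>Gronwall's inequality in both directions from \<open>x0\<close>: with \<open>K' = k\<close>, the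
  function \<open>E exp (- K)\<close> is nonincreasing and \<open>E exp K\<close> is nondecreasing on \<open>I\<close>.\<close>

lemma gronwall_zero:
  fixes E :: "real \<Rightarrow> real"
  assumes I: "is_interval I" and k: "continuous_on I k"
    and der: "\<And>x. x \<in> I \<Longrightarrow> (E has_real_derivative E' x) (at x within I)"
    and bound: "\<And>x. x \<in> I \<Longrightarrow> \<bar>E' x\<bar> \<le> k x * E x"
    and x0: "x0 \<in> I" "E x0 = 0" and x: "x \<in> I"
  shows "E x \<le> 0"
proof -
  obtain K where K: "\<And>x. x \<in> I \<Longrightarrow> (K has_real_derivative k x) (at x within I)"
    using antiderivative_on_interval[OF I k] by blast
  show ?thesis
  proof (cases "x0 \<le> x")
    case True
    have "- (E x0 * exp (- K x0)) \<le> - (E x * exp (- K x))"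
    proof (rule nondecreasing_on_interval[OF I x0(1) x True])
      fix t assume t: "t \<in> I"
      show "((\<lambda>t. - (E t * exp (- K t))) has_real_derivative
          (k t * E t - E' t) * exp (- K t)) (at t within I)"
        by (rule derivative_eq_intros der[OF t] K[OF t] refl)+ (simp add: algebra_simps)
      show "0 \<le> (k t * E t - E' t) * exp (- K t)"
        using bound[OF t] by simp
    qed
    then show ?thesis using x0(2) by (simp add: mult_le_0_iff)
  next
    case False
    then have le: "x \<le> x0" by simp
    have "E x * exp (K x) \<le> E x0 * exp (K x0)"
    proof (rule nondecreasing_on_interval[OF I x x0(1) le])
      fix t assume t: "t \<in> I"
      show "((\<lambda>t. E t * exp (K t)) has_real_derivative
          (k t * E t + E' t) * exp (K t)) (at t within I)"
        by (rule derivative_eq_intros der[OF t] K[OF t] refl)+ (simp add: algebra_simps)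
      show "0 \<le> (k t * E t + E' t) * exp (K t)"
        using bound[OF t] by simp
    qed
    then show ?thesis using x0(2) by (simp add: mult_le_0_iff)
  qed
qed

text \<open>The differential equation gives \<open>E' = 2 u u' - 2 p1 u'\<^sup>2 - 2 p2 u u'\<close> for the
  energy \<open>E = u\<^sup>2 + u'\<^sup>2\<close>, and \<open>2 \<bar>u u'\<bar> \<le> E\<close>.\<close>

lemma homogeneous_unique:
  fixes u u' u'' p1 p2 :: "real \<Rightarrow> real"
  assumes I: "is_interval I" and p1: "continuous_on I p1" and p2: "continuous_on I p2"
    and u: "\<And>x. x \<in> I \<Longrightarrow> (u has_real_derivative u' x) (at x within I)"
    and u': "\<And>x. x \<in> I \<Longrightarrow> (u' has_real_derivative u'' x) (at x within I)"
    and ode: "\<And>x. x \<in> I \<Longrightarrow> u'' x + p1 x * u' x + p2 x * u x = 0"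
    and x0: "x0 \<in> I" "u x0 = 0" "u' x0 = 0" and x: "x \<in> I"
  shows "u x = 0"
proof -
  define E where "E = (\<lambda>x. (u x)\<^sup>2 + (u' x)\<^sup>2)"
  define k where "k = (\<lambda>x. 1 + 2 * \<bar>p1 x\<bar> + \<bar>p2 x\<bar>)"
  have "E x \<le> 0"
  proof (rule gronwall_zero[OF I _ _ _ x0(1) _ x])
    show "continuous_on I k"
      unfolding k_def by (intro continuous_intros p1 p2)
    show "E x0 = 0" using x0 by (simp add: E_def)
    fix t assume t: "t \<in> I"
    show "(E has_real_derivative 2 * u t * u' t + 2 * u' t * u'' t) (at t within I)"
      unfolding E_def by (rule derivative_eq_intros u[OF t] u'[OF t] refl)+ simp
    have uu: "\<bar>2 * u t * u' t\<bar> \<le> E t"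
      using sum_squares_bound[of "\<bar>u t\<bar>" "\<bar>u' t\<bar>"] by (simp add: E_def abs_mult)
    have u'': "u'' t = - p1 t * u' t - p2 t * u t"
      using ode[OF t] by simp
    have "2 * u t * u' t + 2 * u' t * u'' t
        = 2 * u t * u' t + (- 2 * p1 t * (u' t)\<^sup>2 + - p2 t * (2 * u t * u' t))"
      unfolding u'' by (simp add: algebra_simps power2_eq_square)
    also have "\<bar>\<dots>\<bar> \<le> \<bar>2 * u t * u' t\<bar> + (\<bar>- 2 * p1 t * (u' t)\<^sup>2\<bar> + \<bar>- p2 t * (2 * u t * u' t)\<bar>)"
      by linarith
    also have "\<dots> = \<bar>2 * u t * u' t\<bar> + (2 * \<bar>p1 t\<bar> * (u' t)\<^sup>2 + \<bar>p2 t\<bar> * \<bar>2 * u t * u' t\<bar>)"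
      by (simp add: abs_mult)
    also have "\<dots> \<le> E t + (2 * \<bar>p1 t\<bar> * E t + \<bar>p2 t\<bar> * E t)"
      using uu by (intro add_mono mult_left_mono) (auto simp: E_def)
    also have "\<dots> = k t * E t"
      by (simp add: k_def algebra_simps)
    finally show "\<bar>2 * u t * u' t + 2 * u' t * u'' t\<bar> \<le> k t * E t" .
  qed
  then show ?thesis
    by (simp add: E_def sum_power2_le_zero_iff)
qed

lemma wronskian_nonzero:
  fixes y1 y1' y1'' y2 y2' y2'' p1 p2 :: "real \<Rightarrow> real"
  assumes I: "is_interval I" and p1: "continuous_on I p1" and p2: "continuous_on I p2"
    and y1: "\<And>x. x \<in> I \<Longrightarrow> (y1 has_real_derivative y1' x) (at x within I)"
      "\<And>x. x \<in> I \<Longrightarrow> (y1' has_real_derivative y1'' x) (at x within I)"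
      "\<And>x. x \<in> I \<Longrightarrow> y1'' x + p1 x * y1' x + p2 x * y1 x = 0"
    and y2: "\<And>x. x \<in> I \<Longrightarrow> (y2 has_real_derivative y2' x) (at x within I)"
      "\<And>x. x \<in> I \<Longrightarrow> (y2' has_real_derivative y2'' x) (at x within I)"
      "\<And>x. x \<in> I \<Longrightarrow> y2'' x + p1 x * y2' x + p2 x * y2 x = 0"
    and indep: "lin_indep_on I y1 y2" and x0: "x0 \<in> I"
  shows "y1 x0 * y2' x0 - y2 x0 * y1' x0 \<noteq> 0"
proof
  assume W: "y1 x0 * y2' x0 - y2 x0 * y1' x0 = 0"
  have trivial: "a = 0 \<and> b = 0"
    if ab: "a * y1 x0 + b * y2 x0 = 0" "a * y1' x0 + b * y2' x0 = 0" for a b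
  proof -
    have "a * y1 x + b * y2 x = 0" if x: "x \<in> I" for x
    proof (rule homogeneous_unique[where u = "\<lambda>x. a * y1 x + b * y2 x"
          and u' = "\<lambda>x. a * y1' x + b * y2' x" and u'' = "\<lambda>x. a * y1'' x + b * y2'' x",
          OF I p1 p2 _ _ _ x0 ab x])
      fix t assume t: "t \<in> I"
      show "((\<lambda>x. a * y1 x + b * y2 x) has_real_derivative a * y1' t + b * y2' t) (at t within I)"
        by (rule derivative_eq_intros y1(1)[OF t] y2(1)[OF t] refl)+ simp
      show "((\<lambda>x. a * y1' x + b * y2' x) has_real_derivative a * y1'' t + b * y2'' t)
          (at t within I)"
        by (rule derivative_eq_intros y1(2)[OF t] y2(2)[OF t] refl)+ simp
      have "a * y1'' t + b * y2'' t + p1 t * (a * y1' t + b * y2' t) + p2 t * (a * y1 t + b * y2 t)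
          = a * (y1'' t + p1 t * y1' t + p2 t * y1 t) + b * (y2'' t + p1 t * y2' t + p2 t * y2 t)"
        by (simp add: algebra_simps)
      then show "a * y1'' t + b * y2'' t + p1 t * (a * y1' t + b * y2' t)
          + p2 t * (a * y1 t + b * y2 t) = 0"
        using y1(3)[OF t] y2(3)[OF t] by simp
    qed
    then show ?thesis using indep unfolding lin_indep_on_def by blast
  qed
  \<comment> \<open>Each row of the singular matrix \<open>(y1, y2; y1', y2')\<close>, rotated by a right angle, lies in its
    kernel; if both rows vanish, every vector does.\<close>
  have "y2 x0 = 0 \<and> - y1 x0 = 0"
    by (rule trivial) (use W in \<open>simp_all add: algebra_simps\<close>)
  moreover have "y2' x0 = 0 \<and> - y1' x0 = 0"
    by (rule trivial) (use W in \<open>simp_all add: algebra_simps\<close>)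
  ultimately show False
    using trivial[of 1 0] by simp
qed

section \<open>Particular integrals\<close>

text \<open>A nondegenerate interval has no isolated points, so derivatives within it are determined
  by the function. This is what keeps solutions of the inhomogeneous equation from solving the
  homogeneous one.\<close>

lemma solves_ode2_rhs_unique:
  assumes I: "is_interval I" "interior I \<noteq> {}"
    and q: "solves_ode2 I p1 p2 q y" and r: "solves_ode2 I p1 p2 r y" and x: "x \<in> I"
  shows "q x = r x"
proof -
  have nontriv: "at t within I \<noteq> bot" if "t \<in> I" for t
  proof -
    have "I \<noteq> {t}" using I(2) by auto
    then have "t islimpt I"
      using connected_imp_perfect is_interval_connected[OF I(1)] that by blast
    then show ?thesis by (simp add: trivial_limit_within)
  qed
  have unique: "f = g" if "t \<in> I" "(h has_real_derivative f) (at t within I)"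
    "(h has_real_derivative g) (at t within I)" for t f g and h :: "real \<Rightarrow> real"
    using has_field_derivative_unique[OF that(2,3) nontriv[OF that(1)]] .
  obtain u u' where u: "\<And>t. t \<in> I \<Longrightarrow> (y has_real_derivative u t) (at t within I)"
    "\<And>t. t \<in> I \<Longrightarrow> (u has_real_derivative u' t) (at t within I)"
    "\<And>t. t \<in> I \<Longrightarrow> u' t + p1 t * u t + p2 t * y t = q t"
    using q unfolding solves_ode2_def by blast
  obtain v v' where v: "\<And>t. t \<in> I \<Longrightarrow> (y has_real_derivative v t) (at t within I)"
    "\<And>t. t \<in> I \<Longrightarrow> (v has_real_derivative v' t) (at t within I)"
    "\<And>t. t \<in> I \<Longrightarrow> v' t + p1 t * v t + p2 t * y t = r t"
    using r unfolding solves_ode2_def by blast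
  have uv: "u t = v t" if "t \<in> I" for t
    using unique that u(1) v(1) by blast
  have "(u has_real_derivative v' x) (at x within I)"
    using v(2)[OF x] unfolding has_field_derivative_def
    by (rule has_derivative_transform[OF x, rotated]) (rule uv)
  then have "u' x = v' x"
    using unique x u(2) by blast
  then show ?thesis
    using u(3)[OF x] v(3)[OF x] uv[OF x] by simp
qed

theorem mainTheorem1:
  fixes I :: "real set" and p1 p2 q y1 y2 :: "real \<Rightarrow> real"
  assumes "is_interval I" and "interior I \<noteq> {}"
    and "continuous_on I p1" and "continuous_on I p2" and "continuous_on I q"
    and "\<exists>x\<in>I. q x \<noteq> 0"
    and "solves_ode2 I p1 p2 (\<lambda>_. 0) y1" and "solves_ode2 I p1 p2 (\<lambda>_. 0) y2"
    and "lin_indep_on I y1 y2"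
  shows "(\<exists>c1 c2. c1 differentiable_on I \<and> c2 differentiable_on I \<and>
            particular_integral I p1 p2 q (\<lambda>x. c1 x * y1 x + c2 x * y2 x)) \<and>
         (\<forall>y. particular_integral I p1 p2 q y \<longrightarrow>
            (\<exists>c1 c2. c1 differentiable_on I \<and> c2 differentiable_on I \<and>
               (\<forall>x\<in>I. y x = c1 x * y1 x + c2 x * y2 x)))"
proof -
  note I = \<open>is_interval I\<close> \<open>interior I \<noteq> {}\<close>
  note q = \<open>continuous_on I q\<close>
  obtain y1' y1'' where y1: "\<And>x. x \<in> I \<Longrightarrow> (y1 has_real_derivative y1' x) (at x within I)"
    "\<And>x. x \<in> I \<Longrightarrow> (y1' has_real_derivative y1'' x) (at x within I)"
    "\<And>x. x \<in> I \<Longrightarrow> y1'' x + p1 x * y1' x + p2 x * y1 x = 0"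
    using \<open>solves_ode2 I p1 p2 (\<lambda>_. 0) y1\<close> unfolding solves_ode2_def by blast
  obtain y2' y2'' where y2: "\<And>x. x \<in> I \<Longrightarrow> (y2 has_real_derivative y2' x) (at x within I)"
    "\<And>x. x \<in> I \<Longrightarrow> (y2' has_real_derivative y2'' x) (at x within I)"
    "\<And>x. x \<in> I \<Longrightarrow> y2'' x + p1 x * y2' x + p2 x * y2 x = 0"
    using \<open>solves_ode2 I p1 p2 (\<lambda>_. 0) y2\<close> unfolding solves_ode2_def by blast
  define W where "W = (\<lambda>x. y1 x * y2' x - y2 x * y1' x)"
  have W: "W x \<noteq> 0" if "x \<in> I" for x
    unfolding W_def
    by (rule wronskian_nonzero[OF I(1) \<open>continuous_on I p1\<close> \<open>continuous_on I p2\<close>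
          y1 y2 \<open>lin_indep_on I y1 y2\<close> that])
  have y_diff: "y1 differentiable_on I" "y1' differentiable_on I"
    "y2 differentiable_on I" "y2' differentiable_on I"
    using y1 y2 unfolding differentiable_on_def real_differentiable_def by blast+
  have W_diff: "W differentiable_on I"
    unfolding W_def by (intro differentiable_on_diff differentiable_on_mult y_diff)
  note cont = y_diff[THEN differentiable_imp_continuous_on]
    W_diff[THEN differentiable_imp_continuous_on]

  \<comment> \<open>\<open>c1'\<close> and \<open>c2'\<close> come from Cramer's rule for \<open>c1' y1 + c2' y2 = 0\<close> and
    \<open>c1' y1' + c2' y2' = q\<close>.\<close>
  have "continuous_on I (\<lambda>x. - (y2 x * q x) / W x)"
    by (intro continuous_intros cont q) (use W in auto)
  then obtain c1 where c1:
    "\<And>x. x \<in> I \<Longrightarrow> (c1 has_real_derivative - (y2 x * q x) / W x) (at x within I)"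
    using antiderivative_on_interval[OF I(1)] by blast
  have "continuous_on I (\<lambda>x. y1 x * q x / W x)"
    by (intro continuous_intros cont q) (use W in auto)
  then obtain c2 where c2:
    "\<And>x. x \<in> I \<Longrightarrow> (c2 has_real_derivative y1 x * q x / W x) (at x within I)"
    using antiderivative_on_interval[OF I(1)] by blast
  let ?y = "\<lambda>x. c1 x * y1 x + c2 x * y2 x"
  let ?y' = "\<lambda>x. c1 x * y1' x + c2 x * y2' x"
  let ?y'' = "\<lambda>x. c1 x * y1'' x + c2 x * y2'' x + q x"
  have sol: "solves_ode2 I p1 p2 q ?y"
    unfolding solves_ode2_def
  proof (intro exI ballI conjI)
    fix x assume x: "x \<in> I"
    show "(?y has_real_derivative ?y' x) (at x within I)"
      by (rule derivative_eq_intros c1[OF x] c2[OF x] y1(1)[OF x] y2(1)[OF x] refl)+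
        (simp add: algebra_simps)
    have "- (y2 x * q x) / W x * y1' x + y1 x * q x / W x * y2' x = q x * W x / W x"
      by (simp add: W_def algebra_simps diff_divide_distrib)
    then have row2: "- (y2 x * q x) / W x * y1' x + y1 x * q x / W x * y2' x = q x"
      using W[OF x] by simp
    have "(?y' has_real_derivative
        (c1 x * y1'' x + - (y2 x * q x) / W x * y1' x) + (c2 x * y2'' x + y1 x * q x / W x * y2' x))
        (at x within I)"
      by (intro DERIV_add DERIV_mult' c1[OF x] c2[OF x] y1(2)[OF x] y2(2)[OF x])
    also have "(c1 x * y1'' x + - (y2 x * q x) / W x * y1' x)
        + (c2 x * y2'' x + y1 x * q x / W x * y2' x) = ?y'' x"
      using row2 by linarith
    finally show "(?y' has_real_derivative ?y'' x) (at x within I)" .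
    have "?y'' x + p1 x * ?y' x + p2 x * ?y x
        = c1 x * (y1'' x + p1 x * y1' x + p2 x * y1 x)
          + c2 x * (y2'' x + p1 x * y2' x + p2 x * y2 x) + q x"
      by (simp add: algebra_simps)
    then show "?y'' x + p1 x * ?y' x + p2 x * ?y x = q x"
      using y1(3)[OF x] y2(3)[OF x] by simp
  qed
  moreover have "\<not> solves_ode2 I p1 p2 (\<lambda>_. 0) ?y"
    using solves_ode2_rhs_unique[OF I sol] \<open>\<exists>x\<in>I. q x \<noteq> 0\<close> by blast
  moreover have "c1 differentiable_on I" "c2 differentiable_on I"
    using c1 c2 unfolding differentiable_on_def real_differentiable_def by blast+
  ultimately have existence: "\<exists>c1 c2. c1 differentiable_on I \<and> c2 differentiable_on I \<and>
      particular_integral I p1 p2 q (\<lambda>x. c1 x * y1 x + c2 x * y2 x)"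
    unfolding particular_integral_def by blast

  have "\<exists>c1 c2. c1 differentiable_on I \<and> c2 differentiable_on I \<and>
      (\<forall>x\<in>I. y x = c1 x * y1 x + c2 x * y2 x)"
    if part: "particular_integral I p1 p2 q y" for y
  proof -
    obtain y' y'' where y: "\<And>x. x \<in> I \<Longrightarrow> (y has_real_derivative y' x) (at x within I)"
      "\<And>x. x \<in> I \<Longrightarrow> (y' has_real_derivative y'' x) (at x within I)"
      using part unfolding particular_integral_def solves_ode2_def by blast
    have diff: "y differentiable_on I" "y' differentiable_on I"
      using y unfolding differentiable_on_def real_differentiable_def by blast+
    let ?c1 = "\<lambda>x. (y x * y2' x - y2 x * y' x) / W x"
    let ?c2 = "\<lambda>x. (y1 x * y' x - y x * y1' x) / W x"
    have "?c1 differentiable_on I" "?c2 differentiable_on I"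
      using y_diff diff W_diff W unfolding differentiable_on_def
      by (auto intro!: differentiable_divide differentiable_diff differentiable_mult)
    moreover have "y x = ?c1 x * y1 x + ?c2 x * y2 x" if x: "x \<in> I" for x
    proof -
      have "?c1 x * y1 x + ?c2 x * y2 x = y x * W x / W x"
        by (simp add: W_def algebra_simps diff_divide_distrib add_divide_distrib)
      then show ?thesis using W[OF x] by simp
    qed
    ultimately show ?thesis by blast
  qed
  with existence show ?thesis by blast
qed

end
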